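(* Let $(x_0,y_0)\in\operatorname{dom}h_1\times\operatorname{dom}h_2$ and $\bar\varepsilon>0$. Then PB-SPP$(x_0,y_0,\bar\varepsilon)$ is an instance of the inexact proximal point framework IPPF with $\sigma=0$, $\delta_k=\lambda_k\bar\varepsilon/2$, and $\varepsilon_k=\varepsilon_k^x+\varepsilon_k^y$, where $$\varepsilon_k^x=p_k(\tilde x_k)-(\Gamma_k^x+h_1)(x_k)+\frac1{\lambda_k}\langle x_{k-1}-x_k,x_k-\tilde x_k\rangle,$$ $$\varepsilon_k^y=d_k(\tilde y_k)-(-\Gamma_k^y+h_2)(y_k)+\frac1{\lambda_k}\langle y_{k-1}-y_k,y_k-\tilde y_k\rangle.$$
   Context: Saddle-point problem. $f(x,y)$, $(x,y)\in\mathbb R^n\times\mathbb R^m$, is convex in $x$ and concave in $y$; $h_1:\mathbb R^n\to\mathbb R\cup\{+\infty\}$ and $h_2:\mathbb R^m\to\mathbb R\cup\{+\infty\}$ are proper lower semicontinuous convex with $\operatorname{dom}h_1\times\operatorname{dom}h_2\subset\operatorname{dom}f$. The problem is $\min_x\max_y\{\phi(x,y)=f(x,y)+h_1(x)-h_2(y)\}$. Assumptions: there are maps $f_x',f_y'$ on $\operatorname{dom}h_1\times\operatorname{dom}h_2$ with $f_x'(u,v)$ a subgradient of $f(\cdot,v)$ at $u$ and $f_y'(u,v)$ a supergradient of $f(u,\cdot)$ at $v$; $\|f_x'(u,v)\|\le M$ and $\|f_y'(u,v)\|\le M$ for all $(u,v)\in\operatorname{dom}h_1\times\operatorname{dom}h_2$,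 for some $M>0$; $\operatorname{dom}h_1\times\operatorname{dom}h_2$ is bounded with finite diameter $D>0$; the proximal mappings of $h_1$ and $h_2$ are easy to compute; the set of saddle points is nonempty. Write $p_k(u)=f(u,y_{k-1})+h_1(u)$ and $d_k(v)=-f(x_{k-1},v)+h_2(v)$. PDCP (primal-dual cutting-plane) for a pair $(g,h)$, where $h$ is proper lower semicontinuous convex, $g$ is convex with a subgradient oracle $g'$ on $\operatorname{dom}h$, and $\ell_g(u;w)=g(w)+\langle g'(w),u-w\rangle$: PDCP$(w_0,\lambda,\varepsilon)$ with $w_0\in\operatorname{dom}h$ uses $h^\lambda(u)=h(u)+\frac1{2\lambda}\|u-w_0\|^2$, $\Gamma_1=\ell_g(\cdot;w_0)$. For $j=1,2,\dots$: $w_j=\operatorname{argmin}_u\{\Gamma_j(u)+h^\lambda(u)\}$ with minimum value $m_j$; a point $\tilde w_j$ is chosen with $\tilde w_1=w_1$ and $(g+h^\lambda)(\tilde w_j)\le\tau_{j-1}(g+h^\lambda)(\tilde w_{j-1})+(1-\tau_{j-1})(g+h^\lambda)(w_j)$ for $j\ge2$; $t_j=(g+h^\lambda)(\tilde w_j)-m_j$; $\tau_j\in[0,1]$ is selected and $\Gamma_{j+1}$ is any proper lower semicontinuous convex function with $\Gamma_{j+1}\le g$ and $\Gamma_{j+1}\ge\tau_j\bar\Gamma_j+(1-\tau_j)\ell_g(\cdot;w_j)$ for some proper lower semicontinuous convex $\bar\Gamma_j\le g$ with $\bar\Gamma_j(w_j)=\Gamma_j(w_j)$ and $w_j=\operatorname{argmin}_u\{\bar\Gamma_j(u)+h^\lambda(u)\}$.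 It stops at the first $j$ with $t_j\le\varepsilon$ and returns $(w_j,\tilde w_j)$. PB-SPP$(x_0,y_0,\bar\varepsilon)$ (proximal bundle method for the saddle-point problem): for $k=1,2,\dots$, with stepsize $\lambda_k>0$, $(x_k,\tilde x_k)=\text{PDCP}(x_{k-1},\lambda_k,\bar\varepsilon/4)$ applied to $g=f(\cdot,y_{k-1})$, $g'=f_x'(\cdot,y_{k-1})$, $h=h_1$; $(y_k,\tilde y_k)=\text{PDCP}(y_{k-1},\lambda_k,\bar\varepsilon/4)$ applied to $g=-f(x_{k-1},\cdot)$, $g'=-f_y'(x_{k-1},\cdot)$, $h=h_2$; and $\bar x_k=\frac1k\sum_{i=1}^k\tilde x_i$, $\bar y_k=\frac1k\sum_{i=1}^k\tilde y_i$. $\Gamma_k^x$ and $-\Gamma_k^y$ denote the last models $\Gamma_j$ of the two calls, so that $x_k=\operatorname{argmin}_u\{\Gamma_k^x(u)+h_1(u)+\frac1{2\lambda_k}\|u-x_{k-1}\|^2\}$ and $y_k=\operatorname{argmin}_v\{-\Gamma_k^y(v)+h_2(v)+\frac1{2\lambda_k}\|v-y_{k-1}\|^2\}$. IPPF, given an initial pair $(x_0,y_0)\in\operatorname{dom}h_1\times\operatorname{dom}h_2$ and a scalar $\sigma\in[0,1]$: for $k=1,2,\dots$, choose $\lambda_k>0$, $\varepsilon_k>0$ and $\delta_k>0$ and find $(x_k,y_k)\in\operatorname{dom}h_1\times\operatorname{dom}h_2$ and $(\tilde x_k,\tilde y_k)\in\operatorname{dom}h_1\times\operatorname{dom}h_2$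 such that (1) $\left(\frac{x_{k-1}-x_k}{\lambda_k},\frac{y_{k-1}-y_k}{\lambda_k}\right)\in\partial_{\varepsilon_k}[\phi(\cdot,y_{k-1})-\phi(x_{k-1},\cdot)](\tilde x_k,\tilde y_k)$, where the function is $(u,v)\mapsto\phi(u,y_{k-1})-\phi(x_{k-1},v)$ and $\partial_\varepsilon F(z)=\{s:F(w)\ge F(z)+\langle s,w-z\rangle-\varepsilon\ \forall w\}$; (2) $\|x_k-\tilde x_k\|^2+\|y_k-\tilde y_k\|^2+2\lambda_k\varepsilon_k\le\delta_k+\sigma(\|\tilde x_k-x_{k-1}\|^2+\|\tilde y_k-y_{k-1}\|^2)$.
   Formalization: The formal theorem has δ_k = λ_k ε̄ in place of λ_k ε̄/2 (false for f=|x|-|y|, h_i the indicator of [-1,1], x_0=y_0=1/2, λ_k=1, ε̄=4) and requires ε_k ≥ 0 in place of ε_k > 0 (ε_k = 0 when f = 0). *)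

theory Defs
  imports "HOL-Analysis.Analysis"
begin

section \<open>Extended-real-valued convex functions\<close>

definition edom :: "('a \<Rightarrow> ereal) \<Rightarrow> 'a set" where
  "edom F = {x. F x < \<infinity>}"

text \<open>The library predicate \<open>convex_on\<close> needs real values; here \<open>F\<close> may take both infinite values,
  and convexity is convexity of the epigraph, a set of pairs with a real second component.\<close>

definition econvex :: "('a::real_vector \<Rightarrow> ereal) \<Rightarrow> bool" where
  "econvex F \<longleftrightarrow> convex {(x, r::real). F x \<le> ereal r}"

definition lsc :: "('a::topological_space \<Rightarrow> ereal) \<Rightarrow> bool" where
  "lsc F \<longleftrightarrow> (\<forall>x. F x \<le> Liminf (at x) F)"

definition proper :: "('a \<Rightarrow> ereal) \<Rightarrow> bool" where
  "proper F \<longleftrightarrow> (\<forall>x. F x \<noteq> -\<infinity>) \<and> edom F \<noteq> {}"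

definition proper_lsc_convex :: "('a::real_normed_vector \<Rightarrow> ereal) \<Rightarrow> bool" where
  "proper_lsc_convex F \<longleftrightarrow> proper F \<and> lsc F \<and> econvex F"

definition eps_subdiff :: "real \<Rightarrow> ('a::real_inner \<Rightarrow> ereal) \<Rightarrow> 'a \<Rightarrow> 'a set" where
  "eps_subdiff \<epsilon> F z = {s. \<forall>w. F w \<ge> F z + ereal (s \<bullet> (w - z)) - ereal \<epsilon>}"

abbreviation is_argmin :: "('a \<Rightarrow> ereal) \<Rightarrow> 'a \<Rightarrow> bool" where
  "is_argmin F w \<equiv> is_arg_min F (\<lambda>_. True) w"

section \<open>The saddle-point problem\<close>

text \<open>Sums and differences of opposite infinities do not matter below: on
  \<open>edom h1 \<times> UNIV\<close> and \<open>UNIV \<times> edom h2\<close> they do not occur, because \<open>f(\<sqdot>, v)\<close> is minorised by an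
  affine function for \<open>v \<in> edom h2\<close>, and \<open>f(u, \<sqdot>)\<close> is majorised by one for \<open>u \<in> edom h1\<close>.\<close>

definition phi ::
  "('a \<Rightarrow> 'b \<Rightarrow> ereal) \<Rightarrow> ('a \<Rightarrow> ereal) \<Rightarrow> ('b \<Rightarrow> ereal) \<Rightarrow> 'a \<Rightarrow> 'b \<Rightarrow> ereal" where
  "phi f h1 h2 x y = f x y + h1 x - h2 y"

definition saddle_point ::
  "('a \<Rightarrow> 'b \<Rightarrow> ereal) \<Rightarrow> ('a \<Rightarrow> ereal) \<Rightarrow> ('b \<Rightarrow> ereal) \<Rightarrow> 'a \<Rightarrow> 'b \<Rightarrow> bool" where
  "saddle_point f h1 h2 xs ys \<longleftrightarrow> xs \<in> edom h1 \<and> ys \<in> edom h2 \<and>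
     (\<forall>y. phi f h1 h2 xs y \<le> phi f h1 h2 xs ys) \<and>
     (\<forall>x. phi f h1 h2 xs ys \<le> phi f h1 h2 x ys)"

text \<open>The domain of the convex-concave function \<open>f\<close> is the set where it is finite. The supergradient
  condition on \<open>fy\<close> is expressed through the convex function \<open>- f(u, \<sqdot>)\<close>.\<close>

definition saddle_problem ::
  "('a::euclidean_space \<Rightarrow> 'b::euclidean_space \<Rightarrow> ereal) \<Rightarrow> ('a \<Rightarrow> ereal) \<Rightarrow> ('b \<Rightarrow> ereal) \<Rightarrow>
   ('a \<Rightarrow> 'b \<Rightarrow> 'a) \<Rightarrow> ('a \<Rightarrow> 'b \<Rightarrow> 'b) \<Rightarrow> bool" where
  "saddle_problem f h1 h2 fx fy \<longleftrightarrow>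
     (\<forall>y. econvex (\<lambda>x. f x y)) \<and> (\<forall>x. econvex (\<lambda>y. - f x y)) \<and>
     proper_lsc_convex h1 \<and> proper_lsc_convex h2 \<and>
     edom h1 \<times> edom h2 \<subseteq> {(x, y). \<bar>f x y\<bar> \<noteq> \<infinity>} \<and>
     (\<forall>u\<in>edom h1. \<forall>v\<in>edom h2. fx u v \<in> eps_subdiff 0 (\<lambda>x. f x v) u) \<and>
     (\<forall>u\<in>edom h1. \<forall>v\<in>edom h2. - fy u v \<in> eps_subdiff 0 (\<lambda>y. - f u y) v) \<and>
     (\<exists>M>0. \<forall>u\<in>edom h1. \<forall>v\<in>edom h2. norm (fx u v) \<le> M \<and> norm (fy u v) \<le> M) \<and>
     bounded (edom h1 \<times> edom h2) \<and> diameter (edom h1 \<times> edom h2) > 0 \<and>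
     (\<exists>xs ys. saddle_point f h1 h2 xs ys)"

section \<open>The primal-dual cutting-plane method\<close>

definition lin_model :: "('a::real_inner \<Rightarrow> ereal) \<Rightarrow> ('a \<Rightarrow> 'a) \<Rightarrow> 'a \<Rightarrow> 'a \<Rightarrow> ereal" where
  "lin_model g g' w u = g w + ereal (g' w \<bullet> (u - w))"

definition prox_reg :: "('a::real_normed_vector \<Rightarrow> ereal) \<Rightarrow> real \<Rightarrow> 'a \<Rightarrow> 'a \<Rightarrow> ereal" where
  "prox_reg h lam w0 u = h u + ereal ((norm (u - w0))\<^sup>2 / (2 * lam))"

definition model_update ::
  "('a::real_inner \<Rightarrow> ereal) \<Rightarrow> ('a \<Rightarrow> 'a) \<Rightarrow> ('a \<Rightarrow> ereal) \<Rightarrow> real \<Rightarrow> 'a \<Rightarrow> real \<Rightarrow> 'a \<Rightarrow>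
   ('a \<Rightarrow> ereal) \<Rightarrow> ('a \<Rightarrow> ereal) \<Rightarrow> bool" where
  "model_update g g' h lam w0 \<tau> w \<Gamma> \<Gamma>' \<longleftrightarrow>
     proper_lsc_convex \<Gamma>' \<and> (\<forall>u. \<Gamma>' u \<le> g u) \<and>
     (\<exists>\<Gamma>b. proper_lsc_convex \<Gamma>b \<and> (\<forall>u. \<Gamma>b u \<le> g u) \<and> \<Gamma>b w = \<Gamma> w \<and>
        is_argmin (\<lambda>u. \<Gamma>b u + prox_reg h lam w0 u) w \<and>
        (\<forall>u. \<Gamma>' u \<ge> ereal \<tau> * \<Gamma>b u + ereal (1 - \<tau>) * lin_model g g' w u))"

text \<open>A run leaves freedom in the choice of \<open>\<tau>\<close>, of the points \<open>wt j\<close> and of the models, so it is a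
  predicate. \<open>pdcp_run \<dots> N \<Gamma> w wt\<close> describes a run that stops at iteration \<open>N\<close>; the sequences
  are meaningful at the indices \<open>1, \<dots>, N\<close> only.\<close>

definition pdcp_run ::
  "('a::real_inner \<Rightarrow> ereal) \<Rightarrow> ('a \<Rightarrow> 'a) \<Rightarrow> ('a \<Rightarrow> ereal) \<Rightarrow> 'a \<Rightarrow> real \<Rightarrow> real \<Rightarrow>
   nat \<Rightarrow> (nat \<Rightarrow> 'a \<Rightarrow> ereal) \<Rightarrow> (nat \<Rightarrow> 'a) \<Rightarrow> (nat \<Rightarrow> 'a) \<Rightarrow> bool" where
  "pdcp_run g g' h w0 lam \<epsilon> N \<Gamma> w wt \<longleftrightarrow>
     (let G = (\<lambda>u. g u + prox_reg h lam w0 u);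
          m = (\<lambda>j. \<Gamma> j (w j) + prox_reg h lam w0 (w j));
          t = (\<lambda>j. G (wt j) - m j)
      in 1 \<le> N \<and> \<Gamma> 1 = lin_model g g' w0 \<and>
         (\<forall>j\<in>{1..N}. is_argmin (\<lambda>u. \<Gamma> j u + prox_reg h lam w0 u) (w j)) \<and>
         wt 1 = w 1 \<and>
         (\<exists>\<tau>. \<forall>j\<in>{1..<N}. 0 \<le> \<tau> j \<and> \<tau> j \<le> 1 \<and>
            model_update g g' h lam w0 (\<tau> j) (w j) (\<Gamma> j) (\<Gamma> (Suc j)) \<and>
            G (wt (Suc j)) \<le> ereal (\<tau> j) * G (wt j) + ereal (1 - \<tau> j) * G (w (Suc j))) \<and>
         (\<forall>j\<in>{1..<N}. t j > ereal \<epsilon>) \<and> t N \<le> ereal \<epsilon>)"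

text \<open>The call started at \<open>w0\<close> stops with last model \<open>Gam\<close> and returns \<open>(w, wt)\<close>.\<close>

definition pdcp ::
  "('a::real_inner \<Rightarrow> ereal) \<Rightarrow> ('a \<Rightarrow> 'a) \<Rightarrow> ('a \<Rightarrow> ereal) \<Rightarrow> 'a \<Rightarrow> real \<Rightarrow> real \<Rightarrow>
   ('a \<Rightarrow> ereal) \<Rightarrow> 'a \<Rightarrow> 'a \<Rightarrow> bool" where
  "pdcp g g' h w0 lam \<epsilon> Gam w wt \<longleftrightarrow>
     (\<exists>N \<Gamma> ws wts. pdcp_run g g' h w0 lam \<epsilon> N \<Gamma> ws wts \<and> Gam = \<Gamma> N \<and> w = ws N \<and> wt = wts N)"

section \<open>The proximal bundle method for the saddle-point problem\<close>

text \<open>The \<open>y\<close>-call minimises, so its last model is a convex minorant of \<open>- f(x (k-1), \<sqdot>)\<close>; \<open>Gy k\<close> is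
  the negative of that model.\<close>

definition pb_spp ::
  "('a::euclidean_space \<Rightarrow> 'b::euclidean_space \<Rightarrow> ereal) \<Rightarrow> ('a \<Rightarrow> ereal) \<Rightarrow> ('b \<Rightarrow> ereal) \<Rightarrow>
   ('a \<Rightarrow> 'b \<Rightarrow> 'a) \<Rightarrow> ('a \<Rightarrow> 'b \<Rightarrow> 'b) \<Rightarrow> 'a \<Rightarrow> 'b \<Rightarrow> real \<Rightarrow> (nat \<Rightarrow> real) \<Rightarrow>
   (nat \<Rightarrow> 'a) \<Rightarrow> (nat \<Rightarrow> 'b) \<Rightarrow> (nat \<Rightarrow> 'a) \<Rightarrow> (nat \<Rightarrow> 'b) \<Rightarrow>
   (nat \<Rightarrow> 'a \<Rightarrow> ereal) \<Rightarrow> (nat \<Rightarrow> 'b \<Rightarrow> ereal) \<Rightarrow> (nat \<Rightarrow> 'a) \<Rightarrow> (nat \<Rightarrow> 'b) \<Rightarrow> bool" where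
  "pb_spp f h1 h2 fx fy x0 y0 ebar lam x y xt yt Gx Gy xbar ybar \<longleftrightarrow>
     x 0 = x0 \<and> y 0 = y0 \<and>
     (\<forall>k\<ge>1. lam k > 0 \<and>
        pdcp (\<lambda>u. f u (y (k-1))) (\<lambda>u. fx u (y (k-1))) h1
             (x (k-1)) (lam k) (ebar / 4) (Gx k) (x k) (xt k) \<and>
        pdcp (\<lambda>v. - f (x (k-1)) v) (\<lambda>v. - fy (x (k-1)) v) h2
             (y (k-1)) (lam k) (ebar / 4) (\<lambda>v. - Gy k v) (y k) (yt k) \<and>
        xbar k = (1 / real k) *\<^sub>R (\<Sum>i=1..k. xt i) \<and>
        ybar k = (1 / real k) *\<^sub>R (\<Sum>i=1..k. yt i))"

definition eps_x ::
  "('a::real_inner \<Rightarrow> 'b \<Rightarrow> ereal) \<Rightarrow> ('a \<Rightarrow> ereal) \<Rightarrow> (nat \<Rightarrow> real) \<Rightarrow>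
   (nat \<Rightarrow> 'a) \<Rightarrow> (nat \<Rightarrow> 'b) \<Rightarrow> (nat \<Rightarrow> 'a) \<Rightarrow> (nat \<Rightarrow> 'a \<Rightarrow> ereal) \<Rightarrow> nat \<Rightarrow> ereal" where
  "eps_x f h1 lam x y xt Gx k =
     (f (xt k) (y (k-1)) + h1 (xt k)) - (Gx k (x k) + h1 (x k))
     + ereal (1 / lam k * ((x (k-1) - x k) \<bullet> (x k - xt k)))"

definition eps_y ::
  "('a \<Rightarrow> 'b::real_inner \<Rightarrow> ereal) \<Rightarrow> ('b \<Rightarrow> ereal) \<Rightarrow> (nat \<Rightarrow> real) \<Rightarrow>
   (nat \<Rightarrow> 'a) \<Rightarrow> (nat \<Rightarrow> 'b) \<Rightarrow> (nat \<Rightarrow> 'b) \<Rightarrow> (nat \<Rightarrow> 'b \<Rightarrow> ereal) \<Rightarrow> nat \<Rightarrow> ereal" where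
  "eps_y f h2 lam x y yt Gy k =
     (- f (x (k-1)) (yt k) + h2 (yt k)) - (- Gy k (y k) + h2 (y k))
     + ereal (1 / lam k * ((y (k-1) - y k) \<bullet> (y k - yt k)))"

section \<open>The inexact proximal point framework\<close>

text \<open>\<open>eps k = 0\<close> is admitted: for affine \<open>f(\<sqdot>, v)\<close> and \<open>f(u, \<sqdot>)\<close> the cutting-plane models are exact,
  and the subproblems are then solved without error.

  Each of the two calls in \<open>pb_spp\<close> stops with \<open>t \<le> ebar / 4\<close> and contributes
  \<open>2 * lam k * t\<close>, at most \<open>lam k * ebar / 2\<close>, to the left-hand side of the last inequality below, so
  that \<open>\<delta> k = lam k * ebar\<close> is the tolerance that corresponds to the pair of calls.\<close>

definition ippf ::
  "('a::euclidean_space \<Rightarrow> 'b::euclidean_space \<Rightarrow> ereal) \<Rightarrow> ('a \<Rightarrow> ereal) \<Rightarrow> ('b \<Rightarrow> ereal) \<Rightarrow>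
   'a \<Rightarrow> 'b \<Rightarrow> real \<Rightarrow> (nat \<Rightarrow> real) \<Rightarrow> (nat \<Rightarrow> real) \<Rightarrow> (nat \<Rightarrow> real) \<Rightarrow>
   (nat \<Rightarrow> 'a) \<Rightarrow> (nat \<Rightarrow> 'b) \<Rightarrow> (nat \<Rightarrow> 'a) \<Rightarrow> (nat \<Rightarrow> 'b) \<Rightarrow> bool" where
  "ippf f h1 h2 x0 y0 \<sigma> lam eps \<delta> x y xt yt \<longleftrightarrow>
     x0 \<in> edom h1 \<and> y0 \<in> edom h2 \<and> 0 \<le> \<sigma> \<and> \<sigma> \<le> 1 \<and> x 0 = x0 \<and> y 0 = y0 \<and>
     (\<forall>k\<ge>1. lam k > 0 \<and> eps k \<ge> 0 \<and> \<delta> k > 0 \<and>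
        x k \<in> edom h1 \<and> y k \<in> edom h2 \<and> xt k \<in> edom h1 \<and> yt k \<in> edom h2 \<and>
        ((1 / lam k) *\<^sub>R (x (k-1) - x k), (1 / lam k) *\<^sub>R (y (k-1) - y k))
          \<in> eps_subdiff (eps k)
              (\<lambda>(u, v). phi f h1 h2 u (y (k-1)) - phi f h1 h2 (x (k-1)) v) (xt k, yt k) \<and>
        (norm (x k - xt k))\<^sup>2 + (norm (y k - yt k))\<^sup>2 + 2 * lam k * eps k
          \<le> \<delta> k + \<sigma> * ((norm (xt k - x (k-1)))\<^sup>2 + (norm (yt k - y (k-1)))\<^sup>2))"

end

theory Submission
  imports Defs
begin

text \<open>
  Each step of the method makes two independent calls of the cutting-plane scheme, and each call,
  run on a pair \<open>(g, h)\<close> from the centre \<open>w0\<close>, ends with a convex model \<open>\<Gamma> \<le> g\<close> and the exact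
  minimiser \<open>w\<close> of \<open>\<Gamma> + h + \<parallel>\<cdot> - w0\<parallel>\<^sup>2 / (2 \<lambda>)\<close>. Optimality of \<open>w\<close> says that \<open>s = (w0 - w) / \<lambda>\<close> is a
  subgradient of \<open>\<Gamma> + h\<close> at \<open>w\<close> (\<open>prox_argmin_subgradient\<close>). Since \<open>\<Gamma> \<le> g\<close>, the affine minorant
  that \<open>s\<close> defines lies below \<open>g + h\<close> too; recentred at the returned point \<open>wt\<close>, it shows that
  \<open>s\<close> is an \<open>e\<close>-subgradient of \<open>g + h\<close> at \<open>wt\<close>, where \<open>e\<close> is the gap at \<open>wt\<close> between \<open>g + h\<close> and
  the minorant. The error in the theorem is the sum of
  the two gaps.

  Expanding \<open>\<parallel>w0 - wt\<parallel>\<^sup>2\<close> around \<open>w\<close> gives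
  \<open>\<parallel>w - wt\<parallel>\<^sup>2 + 2 \<lambda> e = 2 \<lambda> t\<close>, with \<open>t\<close> the primal-dual gap that the stopping test bounds
  (\<open>pdcp_certificate\<close>). So the residual inequality of the proximal point framework is the
  stopping test in another form: each call contributes at most \<open>2 \<lambda>\<close> times its tolerance.

  Finally, \<open>\<phi>(u, y) - \<phi>(x, v)\<close> with \<open>(x, y)\<close> fixed is, up to a constant, the sum of a function of
  \<open>u\<close> and a function of \<open>v\<close>, namely those that the two calls handle; approximate
  subgradients of the summands combine to one of the sum, with the errors added
  (\<open>eps_subdiff_separable_sum\<close>). All that remains is that no undefined
  sums of infinities arise, and that the iterates stay in the domains.
\<close>

section \<open>Convex models and the proximal subproblem\<close>

lemma lin_model_econvex:
  assumes "\<bar>g w\<bar> \<noteq> \<infinity>"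
  shows "econvex (lin_model g g' w)"
proof -
  obtain c where c: "g w = ereal c" using assms by auto
  have eq: "{(u, r::real). lin_model g g' w u \<le> ereal r}
      = {p. (g' w, -1) \<bullet> p \<le> g' w \<bullet> w - c}"
    by (auto simp: lin_model_def c inner_diff_right)
  show ?thesis unfolding econvex_def eq by (rule convex_halfspace_le)
qed

lemma econvex_segment:
  assumes "econvex F" "F w \<le> ereal a" "F u \<le> ereal b" "0 \<le> t" "t \<le> 1"
  shows "F (w + t *\<^sub>R (u - w)) \<le> ereal (a + t * (b - a))"
proof -
  have "(1 - t) *\<^sub>R (w, a) + t *\<^sub>R (u, b) \<in> {(x, r::real). F x \<le> ereal r}"
    using assms by (intro convexD) (auto simp: econvex_def)
  then show ?thesis by (simp add: algebra_simps)
qed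

text \<open>
  The first-order condition for a proximal step, obtained without a sum rule for subdifferentials:
  along the segment from \<open>w\<close> to \<open>u\<close> the convex part grows at most linearly, so minimality of \<open>w\<close>
  bounds the linear term below by a quadratic one, which disappears in the limit at \<open>w\<close>.
\<close>

lemma prox_argmin_subgradient:
  fixes \<Gamma> h :: "'a::real_inner \<Rightarrow> ereal"
  assumes \<Gamma>: "econvex \<Gamma>" "\<And>u. \<Gamma> u \<noteq> -\<infinity>" and h: "econvex h" "\<And>u. h u \<noteq> -\<infinity>"
    and "lam > 0"
    and min: "is_argmin (\<lambda>u. \<Gamma> u + prox_reg h lam w0 u) w"
    and a: "\<Gamma> w = ereal a" and b: "h w = ereal b"
  shows "ereal (a + b + ((1 / lam) *\<^sub>R (w0 - w)) \<bullet> (u - w)) \<le> \<Gamma> u + h u"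
proof (cases "\<Gamma> u = \<infinity> \<or> h u = \<infinity>")
  case True
  then show ?thesis using \<Gamma>(2) h(2) by auto
next
  case False
  then obtain c d where c: "\<Gamma> u = ereal c" and d: "h u = ereal d"
    using \<Gamma>(2)[of u] h(2)[of u] by (cases "\<Gamma> u"; cases "h u") auto
  define p where "p = (w0 - w) \<bullet> (u - w)"
  define q where "q = (norm (u - w))\<^sup>2"
  have key: "p / lam - (c + d - a - b) \<le> t * (q / (2 * lam))" if t: "0 < t" "t \<le> 1" for t
  proof -
    define z where "z = w + t *\<^sub>R (u - w)"
    have Gz: "\<Gamma> z \<le> ereal (a + t * (c - a))"
      unfolding z_def using t a c by (intro econvex_segment \<Gamma>) auto
    have hz: "h z \<le> ereal (b + t * (d - b))"
      unfolding z_def using t b d by (intro econvex_segment h) auto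
    have nz: "(norm (z - w0))\<^sup>2 = (norm (w - w0))\<^sup>2 - 2 * t * p + t\<^sup>2 * q"
      unfolding z_def p_def q_def power2_norm_eq_inner
      by (simp add: inner_commute algebra_simps power2_eq_square)
    have "\<Gamma> w + prox_reg h lam w0 w \<le> \<Gamma> z + prox_reg h lam w0 z"
      using min by (simp add: is_arg_min_linorder)
    also have "\<dots> \<le> ereal (a + t * (c - a))
        + (ereal (b + t * (d - b)) + ereal ((norm (z - w0))\<^sup>2 / (2 * lam)))"
      unfolding prox_reg_def by (intro add_mono Gz hz) auto
    finally have "a + b + (norm (w - w0))\<^sup>2 / (2 * lam)
        \<le> a + t * (c - a) + b + t * (d - b) + (norm (z - w0))\<^sup>2 / (2 * lam)"
      by (simp add: prox_reg_def a b)
    then have "t * (p / lam - (c + d - a - b)) \<le> t * (t * (q / (2 * lam)))"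
      unfolding nz using \<open>lam > 0\<close>
      by (simp add: field_simps power2_eq_square)
    then show ?thesis using t by (simp only: mult_le_cancel_left_pos)
  qed
  have "((\<lambda>t. t * (q / (2 * lam))) \<longlongrightarrow> 0 * (q / (2 * lam))) (at_right 0)"
    by (intro tendsto_intros)
  moreover have "\<forall>\<^sub>F t in at_right 0. p / lam - (c + d - a - b) \<le> t * (q / (2 * lam))"
    using eventually_at_right_real[of 0 "1::real"] key by (auto elim!: eventually_mono)
  ultimately have "p / lam - (c + d - a - b) \<le> 0 * (q / (2 * lam))"
    by (intro tendsto_lowerbound) auto
  then show ?thesis by (simp add: c d p_def)
qed

section \<open>What a call of the cutting-plane method certifies\<close>

lemma pdcp_last_model:
  assumes "pdcp g g' h w0 lam \<epsilon> \<Gamma> w wt"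
    and "\<bar>g w0\<bar> \<noteq> \<infinity>" and "g' w0 \<in> eps_subdiff 0 g w0"
  shows "econvex \<Gamma>" "\<Gamma> u \<noteq> -\<infinity>" "\<Gamma> u \<le> g u"
    and "is_argmin (\<lambda>u. \<Gamma> u + prox_reg h lam w0 u) w"
    and "g wt + prox_reg h lam w0 wt - (\<Gamma> w + prox_reg h lam w0 w) \<le> ereal \<epsilon>"
proof -
  obtain N M ws wts where run: "pdcp_run g g' h w0 lam \<epsilon> N M ws wts"
    and ret: "\<Gamma> = M N" "w = ws N" "wt = wts N"
    using assms(1) unfolding pdcp_def by blast
  from run have "1 \<le> N" and M1: "M 1 = lin_model g g' w0"
    and "is_argmin (\<lambda>u. M N u + prox_reg h lam w0 u) (ws N)"
    and "g (wts N) + prox_reg h lam w0 (wts N)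
           - (M N (ws N) + prox_reg h lam w0 (ws N)) \<le> ereal \<epsilon>"
    and upd: "\<And>j. j \<in> {1..<N} \<Longrightarrow>
      \<exists>\<tau>. model_update g g' h lam w0 \<tau> (ws j) (M j) (M (Suc j))"
    unfolding pdcp_run_def Let_def by auto
  then show "is_argmin (\<lambda>u. \<Gamma> u + prox_reg h lam w0 u) w"
    and "g wt + prox_reg h lam w0 wt - (\<Gamma> w + prox_reg h lam w0 w) \<le> ereal \<epsilon>"
    by (simp_all add: ret)
  have "econvex \<Gamma> \<and> \<Gamma> u \<noteq> -\<infinity> \<and> \<Gamma> u \<le> g u"
  proof (cases "N = 1")
    case True
    then have "\<Gamma> = lin_model g g' w0" using M1 ret by simp
    moreover have "lin_model g g' w0 u \<le> g u"
      using assms(3) by (simp add: eps_subdiff_def lin_model_def)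
    moreover have "lin_model g g' w0 u \<noteq> -\<infinity>"
      using assms(2) by (auto simp: lin_model_def)
    ultimately show ?thesis using lin_model_econvex[of g w0 g'] assms(2) by auto
  next
    case False
    then have "N - 1 \<in> {1..<N}" "Suc (N - 1) = N" using \<open>1 \<le> N\<close> by auto
    then show ?thesis
      using upd[of "N - 1"] by (auto simp: ret model_update_def proper_lsc_convex_def proper_def)
  qed
  then show "econvex \<Gamma>" "\<Gamma> u \<noteq> -\<infinity>" "\<Gamma> u \<le> g u" by auto
qed

text \<open>
  The affine minorant of \<open>g + h\<close> with slope \<open>(w0 - w) / lam\<close> through the value of the model at \<open>w\<close> is
  compared with \<open>g + h\<close> at \<open>wt\<close>. The gap \<open>e\<close> between them serves as subgradient error, is nonnegative
  because the minorant is one, and turns into the primal-dual gap by completing the square.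
\<close>

lemma pdcp_certificate:
  fixes g h :: "'a::real_inner \<Rightarrow> ereal"
  assumes run: "pdcp g g' h w0 lam \<epsilon> \<Gamma> w wt"
    and h: "proper_lsc_convex h" and "w0 \<in> edom h" and "lam > 0"
    and gfin: "\<bar>g w0\<bar> \<noteq> \<infinity>" and sub: "g' w0 \<in> eps_subdiff 0 g w0"
  obtains e where "w \<in> edom h" "wt \<in> edom h" "e \<ge> 0"
    and "ereal e = (g wt + h wt) - (\<Gamma> w + h w) + ereal (1 / lam * ((w0 - w) \<bullet> (w - wt)))"
    and "(1 / lam) *\<^sub>R (w0 - w) \<in> eps_subdiff e (\<lambda>u. g u + h u) wt"
    and "(norm (w - wt))\<^sup>2 + 2 * lam * e \<le> 2 * lam * \<epsilon>"
proof -
  note model = pdcp_last_model[OF run gfin sub]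
  have hconv: "econvex h" and hninf: "h u \<noteq> -\<infinity>" for u
    using h by (auto simp: proper_lsc_convex_def proper_def)
  have gninf: "g u \<noteq> -\<infinity>" for u
    using model(2,3)[of u] by auto
  \<comment> \<open>The minimum of the subproblem is finite because its objective is finite at the centre.\<close>
  have "\<Gamma> w + prox_reg h lam w0 w \<le> \<Gamma> w0 + prox_reg h lam w0 w0"
    using model(4) by (simp add: is_arg_min_linorder)
  also have "\<dots> \<le> g w0 + h w0"
    by (simp add: prox_reg_def add_right_mono model(3))
  also have "\<dots> < \<infinity>" using gfin \<open>w0 \<in> edom h\<close> by (auto simp: edom_def)
  finally obtain a b where a: "\<Gamma> w = ereal a" and b: "h w = ereal b"
    using model(2)[of w] hninf[of w] by (cases "\<Gamma> w"; cases "h w") (auto simp: prox_reg_def)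
  \<comment> \<open>Hence the stopping test forces the objective to be finite at the returned point as well.\<close>
  obtain c d where c: "g wt = ereal c" and d: "h wt = ereal d"
    using model(5) gninf[of wt] hninf[of wt]
    by (cases "g wt"; cases "h wt") (auto simp: prox_reg_def a b)
  define s where "s = (1 / lam) *\<^sub>R (w0 - w)"
  define e where "e = c + d - (a + b) + s \<bullet> (w - wt)"
  have minorant: "ereal (a + b + s \<bullet> (u - w)) \<le> g u + h u" for u
  proof -
    have "ereal (a + b + s \<bullet> (u - w)) \<le> \<Gamma> u + h u"
      unfolding s_def
      by (rule prox_argmin_subgradient[OF model(1,2) hconv hninf \<open>lam > 0\<close> model(4) a b])
    also have "\<dots> \<le> g u + h u" by (intro add_right_mono model(3))
    finally show ?thesis .
  qed
  show thesis
  proof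
    show "w \<in> edom h" "wt \<in> edom h" using b d by (auto simp: edom_def)
    show "e \<ge> 0"
      using minorant[of wt] by (simp add: e_def c d inner_diff_right)
    show "ereal e = (g wt + h wt) - (\<Gamma> w + h w) + ereal (1 / lam * ((w0 - w) \<bullet> (w - wt)))"
      by (simp add: e_def s_def a b c d)
    have "g wt + h wt + ereal (s \<bullet> (u - wt)) - ereal e \<le> g u + h u" for u
      using minorant[of u] by (simp add: e_def c d inner_diff_right algebra_simps)
    then show "(1 / lam) *\<^sub>R (w0 - w) \<in> eps_subdiff e (\<lambda>u. g u + h u) wt"
      by (simp add: eps_subdiff_def s_def)
    have gap: "c + d + (norm (wt - w0))\<^sup>2 / (2 * lam) - (a + b + (norm (w - w0))\<^sup>2 / (2 * lam)) \<le> \<epsilon>"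
      using model(5) by (simp add: prox_reg_def a b c d add.assoc)
    have square: "(norm (w - wt))\<^sup>2 + 2 * ((w0 - w) \<bullet> (w - wt))
        = (norm (wt - w0))\<^sup>2 - (norm (w - w0))\<^sup>2"
      unfolding power2_norm_eq_inner by (simp add: inner_commute algebra_simps)
    have "lam * (s \<bullet> (w - wt)) = (w0 - w) \<bullet> (w - wt)"
      using \<open>lam > 0\<close> by (simp add: s_def)
    then have "(norm (w - wt))\<^sup>2 + 2 * lam * e
        = 2 * lam * (c + d - (a + b)) + ((norm (w - wt))\<^sup>2 + 2 * ((w0 - w) \<bullet> (w - wt)))"
      by (simp add: e_def algebra_simps)
    also have "\<dots> = 2 * lam * (c + d + (norm (wt - w0))\<^sup>2 / (2 * lam)
        - (a + b + (norm (w - w0))\<^sup>2 / (2 * lam)))"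
      unfolding square using \<open>lam > 0\<close> by (simp add: field_simps)
    also have "\<dots> \<le> 2 * lam * \<epsilon>"
      using gap \<open>lam > 0\<close> by (intro mult_left_mono) auto
    finally show "(norm (w - wt))\<^sup>2 + 2 * lam * e \<le> 2 * lam * \<epsilon>" .
  qed
qed

section \<open>Combining the two calls\<close>

text \<open>
  Finiteness of \<open>P\<close> and \<open>Q\<close> at the base point makes the left-hand sides of the two subgradient
  inequalities real, so that the inequalities can be added even where \<open>P\<close> or \<open>Q\<close> is infinite.
\<close>

lemma eps_subdiff_separable_sum:
  fixes P :: "'a::real_inner \<Rightarrow> ereal" and Q :: "'b::real_inner \<Rightarrow> ereal"
  assumes s: "s \<in> eps_subdiff e1 P a" and t: "t \<in> eps_subdiff e2 Q b"
    and fin: "\<bar>P a\<bar> \<noteq> \<infinity>" "\<bar>Q b\<bar> \<noteq> \<infinity>"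
  shows "(s, t) \<in> eps_subdiff (e1 + e2) (\<lambda>(u, v). P u + Q v + ereal c) (a, b)"
proof -
  obtain p q where p: "P a = ereal p" and q: "Q b = ereal q" using fin by auto
  have "ereal (p + s \<bullet> (u - a) - e1) + ereal (q + t \<bullet> (v - b) - e2) + ereal c
      \<le> P u + Q v + ereal c" for u v
    using s t by (intro add_right_mono add_mono) (auto simp: eps_subdiff_def p q)
  then show ?thesis by (simp add: eps_subdiff_def p q algebra_simps)
qed

text \<open>
  Under these hypotheses each side contains infinities of one sign only, so the terms can be
  regrouped as if they were real.
\<close>

lemma phi_difference_separates:
  assumes "f u y \<noteq> -\<infinity>" "h1 u \<noteq> -\<infinity>" "f x v \<noteq> \<infinity>" "h2 v \<noteq> -\<infinity>"
    and "h1 x = ereal p" "h2 y = ereal q"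
  shows "phi f h1 h2 u y - phi f h1 h2 x v
      = (f u y + h1 u) + (- f x v + h2 v) + ereal (- p - q)"
  using assms unfolding phi_def
  by (cases "f u y"; cases "h1 u"; cases "f x v"; cases "h2 v") auto

lemma eps_subdiff_zero_not_MInfty:
  assumes "s \<in> eps_subdiff 0 g w" "\<bar>g w\<bar> \<noteq> \<infinity>"
  shows "g u \<noteq> -\<infinity>"
  using assms by (auto simp: eps_subdiff_def dest!: spec[of _ u])

text \<open>
  One iteration with centre \<open>(x', y')\<close>. That the new iterate lies in the domains is part of the
  conclusion because this is what makes it admissible as the next centre.
\<close>

lemma pb_spp_step:
  fixes f :: "'a::euclidean_space \<Rightarrow> 'b::euclidean_space \<Rightarrow> ereal"
  assumes sp: "saddle_problem f h1 h2 fx fy" and x': "x' \<in> edom h1" and y': "y' \<in> edom h2"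
    and "l > 0"
    and callx: "pdcp (\<lambda>u. f u y') (\<lambda>u. fx u y') h1 x' l \<epsilon> G x xt"
    and cally: "pdcp (\<lambda>v. - f x' v) (\<lambda>v. - fy x' v) h2 y' l \<epsilon> H y yt"
  shows "x \<in> edom h1 \<and> y \<in> edom h2 \<and> xt \<in> edom h1 \<and> yt \<in> edom h2 \<and>
    (\<exists>e\<ge>0. ereal e
        = ((f xt y' + h1 xt) - (G x + h1 x) + ereal (1 / l * ((x' - x) \<bullet> (x - xt))))
        + ((- f x' yt + h2 yt) - (H y + h2 y) + ereal (1 / l * ((y' - y) \<bullet> (y - yt)))) \<and>
      ((1 / l) *\<^sub>R (x' - x), (1 / l) *\<^sub>R (y' - y))
        \<in> eps_subdiff e (\<lambda>(u, v). phi f h1 h2 u y' - phi f h1 h2 x' v) (xt, yt) \<and>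
      (norm (x - xt))\<^sup>2 + (norm (y - yt))\<^sup>2 + 2 * l * e \<le> 4 * l * \<epsilon>)"
proof -
  have h1: "proper_lsc_convex h1" and h2: "proper_lsc_convex h2"
    and ffin: "\<And>u v. u \<in> edom h1 \<Longrightarrow> v \<in> edom h2 \<Longrightarrow> \<bar>f u v\<bar> \<noteq> \<infinity>"
    and subx: "fx x' y' \<in> eps_subdiff 0 (\<lambda>u. f u y') x'"
    and suby: "- fy x' y' \<in> eps_subdiff 0 (\<lambda>v. - f x' v) y'"
    using sp x' y' unfolding saddle_problem_def by auto
  have nh1: "h1 u \<noteq> -\<infinity>" and nh2: "h2 v \<noteq> -\<infinity>" for u v
    using h1 h2 by (auto simp: proper_lsc_convex_def proper_def)
  have f0: "\<bar>f x' y'\<bar> \<noteq> \<infinity>" "\<bar>- f x' y'\<bar> \<noteq> \<infinity>" using ffin[OF x' y'] by auto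
  have nfx: "f u y' \<noteq> -\<infinity>" for u
    using eps_subdiff_zero_not_MInfty[OF subx] f0 by auto
  have nfy: "f x' v \<noteq> \<infinity>" for v
    using eps_subdiff_zero_not_MInfty[OF suby, of v] f0 by auto
  obtain p q where p: "h1 x' = ereal p" and q: "h2 y' = ereal q"
    using x' y' nh1[of x'] nh2[of y'] by (cases "h1 x'"; cases "h2 y'") (auto simp: edom_def)
  obtain e1 where e1: "x \<in> edom h1" "xt \<in> edom h1" "e1 \<ge> 0"
    "ereal e1 = (f xt y' + h1 xt) - (G x + h1 x) + ereal (1 / l * ((x' - x) \<bullet> (x - xt)))"
    "(1 / l) *\<^sub>R (x' - x) \<in> eps_subdiff e1 (\<lambda>u. f u y' + h1 u) xt"
    "(norm (x - xt))\<^sup>2 + 2 * l * e1 \<le> 2 * l * \<epsilon>"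
    using pdcp_certificate[OF callx h1 x' \<open>l > 0\<close> f0(1) subx] by blast
  obtain e2 where e2: "y \<in> edom h2" "yt \<in> edom h2" "e2 \<ge> 0"
    "ereal e2 = (- f x' yt + h2 yt) - (H y + h2 y) + ereal (1 / l * ((y' - y) \<bullet> (y - yt)))"
    "(1 / l) *\<^sub>R (y' - y) \<in> eps_subdiff e2 (\<lambda>v. - f x' v + h2 v) yt"
    "(norm (y - yt))\<^sup>2 + 2 * l * e2 \<le> 2 * l * \<epsilon>"
    using pdcp_certificate[OF cally h2 y' \<open>l > 0\<close> f0(2) suby] by blast
  have fin: "\<bar>f xt y' + h1 xt\<bar> \<noteq> \<infinity>" "\<bar>- f x' yt + h2 yt\<bar> \<noteq> \<infinity>"
    using ffin[OF e1(2) y'] ffin[OF x' e2(2)] nh1[of xt] nh2[of yt] e1(2) e2(2)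
    by (auto simp: edom_def)
  have "((1 / l) *\<^sub>R (x' - x), (1 / l) *\<^sub>R (y' - y)) \<in> eps_subdiff (e1 + e2)
      (\<lambda>(u, v). (f u y' + h1 u) + (- f x' v + h2 v) + ereal (- p - q)) (xt, yt)"
    by (rule eps_subdiff_separable_sum[OF e1(5) e2(5) fin])
  also have "(\<lambda>(u, v). (f u y' + h1 u) + (- f x' v + h2 v) + ereal (- p - q))
      = (\<lambda>(u, v). phi f h1 h2 u y' - phi f h1 h2 x' v)"
    using phi_difference_separates[of f _ y' h1 x' _ h2, OF nfx nh1 nfy nh2 p q]
    by (simp add: fun_eq_iff)
  finally have incl: "((1 / l) *\<^sub>R (x' - x), (1 / l) *\<^sub>R (y' - y)) \<in> eps_subdiff (e1 + e2)
      (\<lambda>(u, v). phi f h1 h2 u y' - phi f h1 h2 x' v) (xt, yt)" .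
  have "(norm (x - xt))\<^sup>2 + (norm (y - yt))\<^sup>2 + 2 * l * (e1 + e2) \<le> 4 * l * \<epsilon>"
    using e1(6) e2(6) by (simp add: algebra_simps)
  moreover have "ereal (e1 + e2)
        = ((f xt y' + h1 xt) - (G x + h1 x) + ereal (1 / l * ((x' - x) \<bullet> (x - xt))))
        + ((- f x' yt + h2 yt) - (H y + h2 y) + ereal (1 / l * ((y' - y) \<bullet> (y - yt))))"
    unfolding e1(4)[symmetric] e2(4)[symmetric] by simp
  ultimately show ?thesis using e1(1-3) e2(1-3) incl by (intro conjI exI[of _ "e1 + e2"]) auto
qed

theorem proposition4p7:
  fixes f :: "real ^ 'n \<Rightarrow> real ^ 'm \<Rightarrow> ereal"
    and h1 :: "real ^ 'n \<Rightarrow> ereal" and h2 :: "real ^ 'm \<Rightarrow> ereal"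
    and fx :: "real ^ 'n \<Rightarrow> real ^ 'm \<Rightarrow> real ^ 'n" and fy :: "real ^ 'n \<Rightarrow> real ^ 'm \<Rightarrow> real ^ 'm"
    and x0 :: "real ^ 'n" and y0 :: "real ^ 'm" and ebar :: real and lam :: "nat \<Rightarrow> real"
    and x xt xbar :: "nat \<Rightarrow> real ^ 'n" and y yt ybar :: "nat \<Rightarrow> real ^ 'm"
    and Gx :: "nat \<Rightarrow> real ^ 'n \<Rightarrow> ereal" and Gy :: "nat \<Rightarrow> real ^ 'm \<Rightarrow> ereal"
  assumes "saddle_problem f h1 h2 fx fy"
    and "x0 \<in> edom h1" and "y0 \<in> edom h2" and "ebar > 0"
    and "pb_spp f h1 h2 fx fy x0 y0 ebar lam x y xt yt Gx Gy xbar ybar"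
  shows "\<exists>eps :: nat \<Rightarrow> real.
    (\<forall>k\<ge>1. ereal (eps k) = eps_x f h1 lam x y xt Gx k + eps_y f h2 lam x y yt Gy k) \<and>
    ippf f h1 h2 x0 y0 0 lam eps (\<lambda>k. lam k * ebar) x y xt yt"
proof -
  have lam: "lam k > 0"
    and callx: "pdcp (\<lambda>u. f u (y (k-1))) (\<lambda>u. fx u (y (k-1))) h1
             (x (k-1)) (lam k) (ebar / 4) (Gx k) (x k) (xt k)"
    and cally: "pdcp (\<lambda>v. - f (x (k-1)) v) (\<lambda>v. - fy (x (k-1)) v) h2
             (y (k-1)) (lam k) (ebar / 4) (\<lambda>v. - Gy k v) (y k) (yt k)"
    if "k \<ge> 1" for k
    using assms(5) that unfolding pb_spp_def by blast+
  have start: "x 0 = x0" "y 0 = y0" using assms(5) by (auto simp: pb_spp_def)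
  note step = pb_spp_step[OF assms(1) _ _ lam callx cally]
  have dom: "x k \<in> edom h1 \<and> y k \<in> edom h2" for k
  proof (induction k)
    case 0
    then show ?case using assms(2,3) start by simp
  next
    case (Suc k)
    then show ?case using step[of "Suc k"] by simp
  qed
  have "\<exists>e. k \<ge> 1 \<longrightarrow> xt k \<in> edom h1 \<and> yt k \<in> edom h2 \<and> e \<ge> 0 \<and>
      ereal e = eps_x f h1 lam x y xt Gx k + eps_y f h2 lam x y yt Gy k \<and>
      ((1 / lam k) *\<^sub>R (x (k-1) - x k), (1 / lam k) *\<^sub>R (y (k-1) - y k))
        \<in> eps_subdiff e
            (\<lambda>(u, v). phi f h1 h2 u (y (k-1)) - phi f h1 h2 (x (k-1)) v) (xt k, yt k) \<and>
      (norm (x k - xt k))\<^sup>2 + (norm (y k - yt k))\<^sup>2 + 2 * lam k * e \<le> lam k * ebar" for k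
    using step[of k] dom[of "k - 1"] unfolding eps_x_def eps_y_def by (cases "k \<ge> 1") auto
  then obtain eps where eps: "\<And>k. k \<ge> 1 \<longrightarrow> xt k \<in> edom h1 \<and> yt k \<in> edom h2 \<and> eps k \<ge> 0 \<and>
      ereal (eps k) = eps_x f h1 lam x y xt Gx k + eps_y f h2 lam x y yt Gy k \<and>
      ((1 / lam k) *\<^sub>R (x (k-1) - x k), (1 / lam k) *\<^sub>R (y (k-1) - y k))
        \<in> eps_subdiff (eps k)
            (\<lambda>(u, v). phi f h1 h2 u (y (k-1)) - phi f h1 h2 (x (k-1)) v) (xt k, yt k) \<and>
      (norm (x k - xt k))\<^sup>2 + (norm (y k - yt k))\<^sup>2 + 2 * lam k * eps k \<le> lam k * ebar"
    by metis
  show ?thesis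
    unfolding ippf_def using eps lam dom start assms(2-4) by (intro exI[of _ eps]) auto
qed

end
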